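(* (a) For all integers $n \geq 0$, $0 \leq p_{3,4}(-f_{3,2}(n)) \leq (3n+1)/4$. The lower bound is attained precisely when $(n)_4 \in \{0,2\}^*$, and the upper bound precisely when $n = 4^i$ for some $i \geq 0$. (b) For all integers $n \geq 0$, $0 \leq -f_{3,2}(n) \leq \big((9n+3)/8\big)^{\frac{\log 3}{\log 4}}$.
   Context: Let $t(n)$ be the number of $1$'s in the base-$2$ representation of $n$, taken modulo $2$. Define $f_{3,2}(n) = \sum_{0 \leq i < n} (-1)^{t(3i+2)}$ for $n \geq 0$. For an integer $c \geq 2$, $(n)_c$ is the base-$c$ representation of $n\ge0$ (most significant digit first, no leading zeros, the empty word for $n=0$), and for a digit word $x = a_1\cdots a_t$, $[x]_c = \sum_{i=1}^t a_i c^{t-i}$. Define $p_{3,4}(m) = [(m)_3]_4$ for $m \geq 0$. In regular expressions $^*$ is Kleene star.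
   Formalization: The upper bound in (a) is attained precisely when n = (4^(i+1) − 1)/3 for some i ≥ 0, not when n = 4^i: the printed condition fails at n = 4 (value 2, bound 13/4) and at n = 5 (value 4 equals the bound). *)

theory Defs
  imports Complex_Main
begin

(* Digits most significant first; base_rep c 0 = []. The junk value [] for c < 2 only
   serves termination. *)
function base_rep :: "nat \<Rightarrow> nat \<Rightarrow> nat list" where
  "base_rep c n = (if c < 2 \<or> n = 0 then [] else base_rep c (n div c) @ [n mod c])"
  by pat_completeness auto
termination by (relation "measure snd") auto

declare base_rep.simps [simp del]

definition word_val :: "nat \<Rightarrow> nat list \<Rightarrow> nat" where
  "word_val c x = (\<Sum>i = 1..length x. x ! (i - 1) * c ^ (length x - i))"

definition thue_morse :: "nat \<Rightarrow> nat" where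
  "thue_morse n = count_list (base_rep 2 n) 1 mod 2"

definition f32 :: "nat \<Rightarrow> int" where
  "f32 n = (\<Sum>i<n. (- 1) ^ thue_morse (3 * i + 2))"

definition p34 :: "nat \<Rightarrow> nat" where
  "p34 m = word_val 4 (base_rep 3 m)"

end

theory Submission
  imports Defs
begin

text \<open>
  Write \<open>s(m) = (-1)\<^bsup>t(m)\<^esup>\<close>, \<open>G = - f\<^sub>3\<^sub>,\<^sub>2\<close> and \<open>p = p\<^sub>3\<^sub>,\<^sub>4\<close>. Since \<open>s(2m) = s(m)\<close> and \<open>s(2m+1) = -s(m)\<close>, one gets
  \<open>G(4n+r) = 3 G(n) + d\<close> with \<open>\<bar>d\<bar> \<le> 2\<close>, where \<open>d\<close> depends only on \<open>r\<close>, the parity of \<open>n\<close> and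
  the signs \<open>s(3n)\<close>, \<open>s(3n+1)\<close>, \<open>s(3n+2)\<close>. These signs are constant on the \<open>n\<close> with base-4
  digits 0 and 2, so there \<open>G\<close> stays 0 or becomes 1, and \<open>G(n) \<ge> 1\<close> gives \<open>G(4n+r) \<ge> 1\<close>. As \<open>p(3m+d) = 4 p(m) + d\<close> for \<open>0 \<le> d < 3\<close>, the defect
  \<open>D(n) = 3n + 1 - 4 p(G(n))\<close> satisfies \<open>D(4n+r) \<ge> 4 D(n) - 7\<close>, so \<open>D \<ge> 3\<close> persists; the only
  other values are \<open>D(0) = 1\<close> and \<open>D(n) = 0\<close> for \<open>3n + 1 = 4\<^sup>k\<close>, \<open>k > 0\<close>, and there the signs are
  explicit. Part (b) follows from part (a) and \<open>m\<^sup>\<alpha> \<le> 3 p(m) / 2\<close>, where \<open>\<alpha> = log\<^sub>3 4\<close>.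
\<close>

section \<open>Digit recursions\<close>

lemma base_rep_mult_add:
  assumes "2 \<le> c" "d < c" "0 < m \<or> 0 < d"
  shows "base_rep c (c * m + d) = base_rep c m @ [d]"
proof -
  have "(c * m + d) div c = m" "(c * m + d) mod c = d" "c * m + d \<noteq> 0"
    using assms by auto
  then show ?thesis
    using assms(1) by (subst base_rep.simps) auto
qed

lemma base_rep_0 [simp]: "base_rep c 0 = []"
  by (subst base_rep.simps) simp

lemma word_val_snoc: "word_val c (xs @ [d]) = c * word_val c xs + d"
proof -
  have "(\<Sum>i = 1..length xs. (xs @ [d]) ! (i - 1) * c ^ (Suc (length xs) - i)) =
      (\<Sum>i = 1..length xs. c * (xs ! (i - 1) * c ^ (length xs - i)))"
    by (rule sum.cong) (auto simp: nth_append Suc_diff_le)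
  then show ?thesis
    by (simp add: word_val_def sum_distrib_left)
qed

lemma digit_induct [case_names base zero step]:
  fixes c n :: nat
  assumes c: "2 \<le> c"
    and zero: "P 0"
    and step: "\<And>m d. d < c \<Longrightarrow> 0 < m \<or> 0 < d \<Longrightarrow> P m \<Longrightarrow> P (c * m + d)"
  shows "P n"
proof (induction n rule: less_induct)
  case (less n)
  show ?case
  proof (cases "n = 0")
    case False
    have "n div c < n"
      using c False by auto
    moreover have "0 < n div c \<or> 0 < n mod c"
      using False c by (metis div_mult_mod_eq gr0I mult_0 add_0)
    ultimately have "P (c * (n div c) + n mod c)"
      using c less by (intro step) auto
    then show ?thesis
      by simp
  qed (simp add: zero)
qed

text \<open>For \<open>m = d = 0\<close> the word is empty instead of a single 0;
  \<open>0 \<in> S\<close> keeps the equivalence true there.\<close>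

lemma base_rep_in_lists_iff:
  assumes "2 \<le> c" "d < c" "0 \<in> S"
  shows "base_rep c (c * m + d) \<in> lists S \<longleftrightarrow> base_rep c m \<in> lists S \<and> d \<in> S"
  using assms base_rep_mult_add[of c d m] by (cases "m = 0 \<and> d = 0") auto

lemma word_val_Nil [simp]: "word_val c [] = 0"
  by (simp add: word_val_def)

lemma p34_0 [simp]: "p34 0 = 0"
  by (simp add: p34_def)

lemma p34_mult_add:
  assumes "d < 3"
  shows "p34 (3 * m + d) = 4 * p34 m + d"
  using assms base_rep_mult_add[of 3 d m]
  by (cases "m = 0 \<and> d = 0") (auto simp: p34_def word_val_snoc)

text \<open>Only a carry, \<open>d = 2\<close>, uses the induction hypothesis:
  \<open>4 * p34 m + 2 < 4 * p34 (Suc m)\<close>.\<close>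

lemma p34_less_p34_Suc: "p34 m < p34 (Suc m)"
proof (induction m rule: digit_induct[of 3])
  case zero
  show ?case
    using p34_mult_add[of 1 0] by simp
next
  case (step m d)
  then consider "d = 0" | "d = 1" | "d = 2"
    by linarith
  then show ?case
  proof cases
    case 3
    have "p34 (Suc (3 * m + 2)) = 4 * p34 (Suc m)"
      using p34_mult_add[of 0 "Suc m"] by (simp add: numeral_3_eq_3)
    then show ?thesis
      using step p34_mult_add[of 2 m] 3 by simp
  qed (use p34_mult_add[of 0 m] p34_mult_add[of 1 m] p34_mult_add[of 2 m] in simp_all)
qed simp

lemma p34_eq_0_iff [simp]: "p34 m = 0 \<longleftrightarrow> m = 0"
  using p34_less_p34_Suc[of "m - 1"] by (cases m) auto

definition q34 :: "int \<Rightarrow> int" where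
  "q34 z = int (p34 (nat z))"

lemma q34_mult_add:
  assumes "0 \<le> z" "0 \<le> d" "d < 3"
  shows "q34 (3 * z + d) = 4 * q34 z + d"
proof -
  have "nat (3 * z + d) = 3 * nat z + nat d"
    using assms by (simp add: nat_add_distrib nat_mult_distrib)
  then show ?thesis
    using assms p34_mult_add[of "nat d" "nat z"] by (simp add: q34_def)
qed

lemma q34_pred:
  assumes "1 \<le> z"
  shows "q34 (z - 1) \<le> q34 z - 1"
proof -
  have "Suc (nat (z - 1)) = nat z"
    using assms by simp
  then show ?thesis
    using p34_less_p34_Suc[of "nat (z - 1)"] by (simp add: q34_def)
qed

text \<open>Borrow: \<open>3 * z + d = 3 * (z - 1) + (d + 3)\<close>. The leading part loses at
  least 4, the last digit regains only 3.\<close>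

lemma q34_mult_add_neg:
  assumes "1 \<le> z" "- 3 \<le> d" "d < 0"
  shows "q34 (3 * z + d) < 4 * q34 z + d"
proof -
  have "q34 (3 * (z - 1) + (d + 3)) = 4 * q34 (z - 1) + (d + 3)"
    using assms by (intro q34_mult_add) auto
  moreover have "3 * (z - 1) + (d + 3) = 3 * z + d"
    by simp
  ultimately show ?thesis
    using q34_pred[of z] assms by auto
qed

section \<open>Thue--Morse signs\<close>

definition tm_sign :: "nat \<Rightarrow> int" where
  "tm_sign n = (- 1) ^ thue_morse n"

lemma tm_sign_eq_count: "tm_sign n = (- 1) ^ count_list (base_rep 2 n) 1"
  unfolding tm_sign_def thue_morse_def by (simp add: minus_one_power_iff even_mod_2_iff)

lemma tm_sign_cases: "tm_sign n = 1 \<or> tm_sign n = - 1"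
  by (simp add: tm_sign_def minus_one_power_iff)

lemma tm_sign_0 [simp]: "tm_sign 0 = 1"
  by (simp add: tm_sign_eq_count)

lemma tm_sign_double [simp]: "tm_sign (2 * n) = tm_sign n"
  using base_rep_mult_add[of 2 0 n] by (cases "n = 0") (auto simp: tm_sign_eq_count)

lemma tm_sign_double_Suc [simp]: "tm_sign (Suc (2 * n)) = - tm_sign n"
  using base_rep_mult_add[of 2 1 n] by (auto simp: tm_sign_eq_count)

lemma tm_sign_Suc_even: "even m \<Longrightarrow> tm_sign (Suc m) = - tm_sign m"
  by (auto elim!: evenE)

lemma tm_sign_quad:
  "tm_sign (4 * n) = tm_sign n" "tm_sign (4 * n + 1) = - tm_sign n"
  "tm_sign (4 * n + 2) = - tm_sign n" "tm_sign (4 * n + 3) = tm_sign n"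
proof -
  have "4 * n = 2 * (2 * n)" "4 * n + 1 = Suc (2 * (2 * n))"
    "4 * n + 2 = 2 * Suc (2 * n)" "4 * n + 3 = Suc (2 * Suc (2 * n))"
    by simp_all
  then show "tm_sign (4 * n) = tm_sign n" "tm_sign (4 * n + 1) = - tm_sign n"
    "tm_sign (4 * n + 2) = - tm_sign n" "tm_sign (4 * n + 3) = tm_sign n"
    by (simp_all only: tm_sign_double tm_sign_double_Suc minus_minus)
qed

section \<open>Base-4 recursion for \<open>f32\<close>\<close>

lemma f32_Suc: "f32 (Suc n) = f32 n + tm_sign (3 * n + 2)"
  by (simp add: f32_def tm_sign_def)

text \<open>Modulo 4 the arguments \<open>3 * (4 * n + r) + 2\<close> are 2, 1, 0, 3, with quotients
  \<open>3 * n\<close>, \<open>3 * n + 1\<close>, \<open>3 * n + 2\<close>,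
  \<open>3 * n + 2\<close>; the repeated quotient causes the factor 2.\<close>

lemma f32_quad_steps:
  "f32 (4 * n + 1) = f32 (4 * n) - tm_sign (3 * n)"
  "f32 (4 * n + 2) = f32 (4 * n) - tm_sign (3 * n) - tm_sign (3 * n + 1)"
  "f32 (4 * n + 3) = f32 (4 * n) - tm_sign (3 * n) - tm_sign (3 * n + 1) + tm_sign (3 * n + 2)"
  "f32 (4 * Suc n) = f32 (4 * n) - tm_sign (3 * n) - tm_sign (3 * n + 1) + 2 * tm_sign (3 * n + 2)"
proof -
  have *: "3 * (4 * n) + 2 = 4 * (3 * n) + 2" "3 * (4 * n + 1) + 2 = 4 * (3 * n + 1) + 1"
    "3 * (4 * n + 2) + 2 = 4 * (3 * n + 2)" "3 * (4 * n + 3) + 2 = 4 * (3 * n + 2) + 3"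
    by simp_all
  show 1: "f32 (4 * n + 1) = f32 (4 * n) - tm_sign (3 * n)"
    using f32_Suc[of "4 * n"] unfolding * tm_sign_quad by simp
  show 2: "f32 (4 * n + 2) = f32 (4 * n) - tm_sign (3 * n) - tm_sign (3 * n + 1)"
    using f32_Suc[of "4 * n + 1"] 1 unfolding * tm_sign_quad by simp
  show 3: "f32 (4 * n + 3) =
      f32 (4 * n) - tm_sign (3 * n) - tm_sign (3 * n + 1) + tm_sign (3 * n + 2)"
    using f32_Suc[of "4 * n + 2"] 2 unfolding * tm_sign_quad by (simp add: numeral_3_eq_3)
  show "f32 (4 * Suc n) =
      f32 (4 * n) - tm_sign (3 * n) - tm_sign (3 * n + 1) + 2 * tm_sign (3 * n + 2)"
    using f32_Suc[of "4 * n + 3"] 3 unfolding * tm_sign_quad by (simp add: eval_nat_numeral)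
qed

lemma tm_sign_triple_steps:
  "even n \<Longrightarrow> tm_sign (3 * n + 1) = - tm_sign (3 * n)"
  "even n \<Longrightarrow> tm_sign (3 * Suc n) = - tm_sign (3 * n + 2)"
  "odd n \<Longrightarrow> tm_sign (3 * n + 2) = - tm_sign (3 * n + 1)"
  using tm_sign_Suc_even[of "3 * n"] tm_sign_Suc_even[of "3 * n + 2"]
    tm_sign_Suc_even[of "3 * n + 1"]
  by (simp_all add: numeral_3_eq_3)

text \<open>For even \<open>n\<close> a block of four terms adds \<open>tm_sign (3 * n + 2)\<close>
  only twice, and the missing third copy is the correction at \<open>Suc n\<close>; for odd
  \<open>n\<close> the block cancels the correction.\<close>

lemma f32_quad: "f32 (4 * n) = 3 * f32 n + (if odd n then tm_sign (3 * n) else 0)"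
proof (induction n)
  case 0
  show ?case
    by (simp add: f32_def)
next
  case (Suc n)
  then show ?case
    using f32_quad_steps(4)[of n] f32_Suc[of n] tm_sign_triple_steps[of n]
    by (cases "even n") simp_all
qed

lemma neg_f32_even:
  assumes "even n"
  shows "- f32 (4 * n) = 3 * - f32 n" "- f32 (4 * n + 1) = 3 * - f32 n + tm_sign (3 * n)"
    "- f32 (4 * n + 2) = 3 * - f32 n" "- f32 (4 * n + 3) = 3 * - f32 n - tm_sign (3 * n + 2)"
  using assms f32_quad[of n] f32_quad_steps[of n] tm_sign_triple_steps[of n] by simp_all

lemma neg_f32_odd:
  assumes "odd n"
  shows "- f32 (4 * n) = 3 * - f32 n - tm_sign (3 * n)" "- f32 (4 * n + 1) = 3 * - f32 n"
    "- f32 (4 * n + 2) = 3 * - f32 n + tm_sign (3 * n + 1)"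
    "- f32 (4 * n + 3) = 3 * - f32 n + 2 * tm_sign (3 * n + 1)"
  using assms f32_quad[of n] f32_quad_steps[of n] tm_sign_triple_steps[of n] by simp_all

section \<open>Bounds and their equality cases\<close>

lemma less_4_cases: "(r::nat) < 4 \<Longrightarrow> r = 0 \<or> r = 1 \<or> r = 2 \<or> r = 3"
  by linarith

text \<open>Used when a digit 1 or 3 follows such a prefix: it adds \<open>tm_sign (3 * n)\<close>
  or \<open>- tm_sign (3 * n + 2)\<close>, both 1, so \<open>- f32\<close> leaves 0 upwards.\<close>

lemma digits_02_signs:
  "base_rep 4 n \<in> lists {0, 2} \<Longrightarrow>
    even n \<and> tm_sign (3 * n) = 1 \<and> tm_sign (3 * n + 2) = - 1"
proof (induction n rule: digit_induct[of 4])
  case zero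
  show ?case
    using tm_sign_quad(3)[of 0] by simp
next
  case (step m d)
  then have IH: "even m" "tm_sign (3 * m) = 1" "tm_sign (3 * m + 2) = - 1" and d: "d = 0 \<or> d = 2"
    using base_rep_in_lists_iff[of 4 d "{0, 2}" m] by auto
  have *: "3 * (4 * m) = 4 * (3 * m)" "3 * (4 * m + 2) = 4 * (3 * m + 1) + 2"
    "4 * (3 * m + 1) + 2 + 2 = 4 * (3 * m + 2)"
    by simp_all
  from d show ?case
    using IH tm_sign_triple_steps(1)[of m]
    by (elim disjE) (simp_all only: * tm_sign_quad add_0_right, simp_all)
qed simp

lemma neg_f32_dichotomy:
  "(if base_rep 4 n \<in> lists {0, 2} then - f32 n = 0 else 1 \<le> - f32 n)"
proof (induction n rule: digit_induct[of 4])
  case zero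
  show ?case
    by (simp add: f32_def)
next
  case (step m d)
  have Z: "base_rep 4 (4 * m + d) \<in> lists {0, 2} \<longleftrightarrow> base_rep 4 m \<in> lists {0, 2} \<and> d \<in> {0, 2}"
    using base_rep_in_lists_iff[of 4 d "{0, 2}" m] step by simp
  note d = less_4_cases[OF step(1)]
  show ?case
  proof (cases "base_rep 4 m \<in> lists {0, 2}")
    case True
    then show ?thesis
      using d Z step(3) neg_f32_even[of m] digits_02_signs[of m] by auto
  next
    case False
    then have "1 \<le> - f32 m"
      using step(3) by simp
    then have "1 \<le> - f32 (4 * m + d)"
      using d neg_f32_even[of m] neg_f32_odd[of m] tm_sign_cases[of "3 * m"]
        tm_sign_cases[of "3 * m + 1"] tm_sign_cases[of "3 * m + 2"]
      by (cases "even m") auto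
    then show ?thesis
      using False Z by simp
  qed
qed simp

lemma neg_f32_nonneg: "0 \<le> - f32 n"
  using neg_f32_dichotomy[of n] by (auto split: if_splits)

lemma neg_f32_eq_0_iff: "- f32 n = 0 \<longleftrightarrow> base_rep 4 n \<in> lists {0, 2}"
  using neg_f32_dichotomy[of n] by (auto split: if_splits)

section \<open>Upper bound via the defect\<close>

lemma tm_sign_4_power: "tm_sign (4 ^ k) = - 1"
  using tm_sign_quad(2)[of 0] by (induction k) (simp_all add: tm_sign_quad)

lemma tm_sign_4_power_minus_1: "Suc m = 4 ^ k \<Longrightarrow> tm_sign m = 1"
proof (induction k arbitrary: m)
  case (Suc k)
  have "Suc (4 ^ k - 1) = (4 ^ k :: nat)"
    by simp
  moreover have "m = 4 * (4 ^ k - 1) + 3"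
    using Suc.prems by simp
  ultimately show ?case
    using Suc.IH[of "4 ^ k - 1"] by (metis tm_sign_quad(4))
qed simp

text \<open>Four times the slack in the upper bound, hence an integer.\<close>

definition defect :: "nat \<Rightarrow> int" where
  "defect n = 3 * int n + 1 - 4 * q34 (- f32 n)"

lemma defect_0: "defect 0 = 1"
  by (simp add: defect_def f32_def q34_def)

lemma defect_quad:
  assumes "- 2 \<le> d" "d \<le> 2" "- f32 (4 * n + r) = 3 * - f32 n + d"
  shows "d < 0 \<Longrightarrow> 4 * defect n + 3 * int r - 4 * d < defect (4 * n + r)"
    and "0 \<le> d \<Longrightarrow> defect (4 * n + r) = 4 * defect n + 3 * int r - 3 - 4 * d"
proof -
  \<comment> \<open>For \<open>d < 0\<close> the second fact forces \<open>1 \<le> - f32 n\<close>,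
    as borrowing requires.\<close>
  have nonneg: "0 \<le> - f32 n" "0 \<le> 3 * - f32 n + d"
    using neg_f32_nonneg[of n] neg_f32_nonneg[of "4 * n + r"] unfolding assms(3) by simp_all
  show "4 * defect n + 3 * int r - 4 * d < defect (4 * n + r)" if "d < 0"
    using q34_mult_add_neg[of "- f32 n" d] that nonneg assms(1)
    unfolding defect_def assms(3) by simp
  show "defect (4 * n + r) = 4 * defect n + 3 * int r - 3 - 4 * d" if "0 \<le> d"
    using q34_mult_add[OF nonneg(1) that] assms(2) unfolding defect_def assms(3) by simp
qed

text \<open>The threshold 3 is the least integer \<open>t\<close> with
  \<open>4 * t - 7 \<ge> t\<close>; mere positivity would not be inductive.\<close>

lemma defect_trichotomy:
  "n = 0 \<or> (\<exists>i. 3 * n + 1 = 4 ^ Suc i) \<and> defect n = 0 \<or> 3 \<le> defect n"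
proof (induction n rule: digit_induct[of 4])
  case (step m r)
  note r = less_4_cases[OF step(1)]
  have signs: "tm_sign k = 1 \<or> tm_sign k = - 1" for k
    by (rule tm_sign_cases)
  consider "m = 0" | i where "3 * m + 1 = 4 ^ Suc i" "defect m = 0" | "3 \<le> defect m"
    using step(3) by blast
  then show ?case
  proof cases
    case 1
    have f0: "f32 0 = 0"
      by (simp add: f32_def)
    have "tm_sign 2 = - 1"
      using tm_sign_quad(3)[of 0] by (simp add: numeral_2_eq_2)
    then have "defect 1 = 0" "defect 2 = 7" "defect 3 = 6"
      using defect_quad(2)[of 1 0 1] defect_quad(2)[of 0 0 2] defect_quad(2)[of 1 0 3]
        neg_f32_even[of 0] f0 defect_0 by (simp_all add: numeral_2_eq_2)
    moreover have "\<exists>i. 3 * 1 + 1 = (4::nat) ^ Suc i"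
      by (rule exI[of _ 0]) simp
    ultimately show ?thesis
      using 1 r by auto
  next
    case 2
    have "even (3 * m + 1)"
      unfolding 2(1) by simp
    then have "odd m"
      by simp
    have s: "tm_sign (3 * m) = 1" "tm_sign (3 * m + 1) = - 1"
      using tm_sign_4_power_minus_1[of "3 * m" "Suc i"] tm_sign_4_power[of "Suc i"] 2(1) by simp_all
    \<comment> \<open>The corrections for \<open>r\<close> = 0, 1, 2, 3 are -1, 0, -1, -2: only
      appending the digit 1 avoids a borrow and keeps the defect 0.\<close>
    note G = neg_f32_odd[OF \<open>odd m\<close>, unfolded s]
    have "3 * (4 * m + 1) + 1 = 4 ^ Suc (Suc i)"
      using 2(1) by simp
    then have "\<exists>i. 3 * (4 * m + 1) + 1 = 4 ^ Suc i"
      by blast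
    moreover have "3 \<le> defect (4 * m)"
      using defect_quad(1)[of "- 1" m 0] G(1) 2(2) by simp
    moreover have "defect (4 * m + 1) = 0"
      using defect_quad(2)[of 0 m 1] G(2) 2(2) by simp
    moreover have "3 \<le> defect (4 * m + 2)"
      using defect_quad(1)[of "- 1" m 2] G(3) 2(2) by simp
    moreover have "3 \<le> defect (4 * m + 3)"
      using defect_quad(1)[of "- 2" m 3] G(4) 2(2) by simp
    ultimately show ?thesis
      using r by (metis add_0_right)
  next
    case 3
    \<comment> \<open>The last conjunct caps the loss at 7. It holds because a correction of 2
      occurs only for \<open>r = 3\<close>.\<close>
    have "\<exists>d. - 2 \<le> d \<and> d \<le> 2 \<and> - f32 (4 * m + r) = 3 * - f32 m + d \<and> 4 * d \<le> 3 * int r + 4"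
    proof (cases "even m")
      case True
      then show ?thesis
        using r neg_f32_even[of m] signs[of "3 * m"] signs[of "3 * m + 2"]
        by (intro exI[of _ "- f32 (4 * m + r) - 3 * - f32 m"]) auto
    next
      case False
      then show ?thesis
        using r neg_f32_odd[of m] signs[of "3 * m"] signs[of "3 * m + 1"]
        by (intro exI[of _ "- f32 (4 * m + r) - 3 * - f32 m"]) auto
    qed
    then obtain d where "- 2 \<le> d" "d \<le> 2" "- f32 (4 * m + r) = 3 * - f32 m + d"
      "4 * d \<le> 3 * int r + 4"
      by blast
    then show ?thesis
      using defect_quad[of d m r] 3 by linarith
  qed
qed simp_all

lemma defect_nonneg: "0 \<le> defect n"
  using defect_trichotomy[of n] defect_0 by auto

lemma defect_eq_0_if_4_power: "3 * n + 1 = 4 ^ Suc i \<Longrightarrow> defect n = 0"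
proof (induction i arbitrary: n)
  case 0
  then have "n = 1"
    by simp
  then show ?case
    using defect_quad(2)[of 1 0 1] neg_f32_even(2)[of 0] defect_0 by (simp add: f32_def)
next
  case (Suc i)
  \<comment> \<open>With the power hidden in an even \<open>k\<close>, the remaining arithmetic is
    linear; evenness makes \<open>m\<close> odd.\<close>
  obtain k :: nat where k: "k = 4 ^ Suc i" "even k"
    by simp
  from Suc.prems have "3 * n + 1 = 4 * k"
    by (simp add: k)
  then have "\<exists>m. n = 4 * m + 1 \<and> 3 * m + 1 = k"
    by presburger
  then obtain m where m: "n = 4 * m + 1" "3 * m + 1 = k"
    by blast
  then have "odd m"
    using k(2) by presburger
  then show ?case
    using Suc.IH[of m] defect_quad(2)[of 0 m 1] neg_f32_odd(2)[of m] m k(1) by simp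
qed

text \<open>These \<open>n\<close> are the base-4 repunits 1, 5, 21, ...; the power 4 is not among
  them, as \<open>defect 4 = 5\<close>.\<close>

lemma defect_eq_0_iff: "defect n = 0 \<longleftrightarrow> (\<exists>i. 3 * n + 1 = 4 ^ Suc i)"
proof
  assume "\<exists>i. 3 * n + 1 = 4 ^ Suc i"
  then show "defect n = 0"
    using defect_eq_0_if_4_power by blast
next
  assume "defect n = 0"
  then show "\<exists>i. 3 * n + 1 = 4 ^ Suc i"
    using defect_trichotomy[of n] defect_0 by auto
qed

section \<open>The exponent\<close>

text \<open>Convexity of \<open>x powr a\<close>; \<open>0 < u\<close> keeps the interval inside the
  domain of differentiability.\<close>

lemma powr_diff_mono:
  fixes a c u v :: real
  assumes "1 \<le> a" "0 \<le> c" "0 < u" "u \<le> v"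
  shows "(u + c) powr a - u powr a \<le> (v + c) powr a - v powr a"
proof (rule DERIV_nonneg_imp_nondecreasing[OF assms(4)])
  fix x
  assume "u \<le> x" "x \<le> v"
  then have x: "0 < x"
    using assms by simp
  have "((\<lambda>x. (x + c) powr a - x powr a) has_real_derivative
      a * (x + c) powr (a - 1) - a * x powr (a - 1)) (at x)"
    using x assms by (auto intro!: derivative_eq_intros)
  moreover have "x powr (a - 1) \<le> (x + c) powr (a - 1)"
    using x assms by (intro powr_mono2) auto
  ultimately show "\<exists>y. ((\<lambda>x. (x + c) powr a - x powr a) has_real_derivative y) (at x) \<and> 0 \<le> y"
    using assms by (intro exI[of _ "a * (x + c) powr (a - 1) - a * x powr (a - 1)"])
      (auto simp: mult_left_mono)
qed

text \<open>Uses \<open>4 ^ 7 \<le> 3 ^ 9\<close> and \<open>2 ^ 9 \<le> (5/2) ^ 7\<close>.\<close>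

lemma two_powr_log34: "2 powr log 3 4 \<le> (5/2::real)"
proof -
  have "7 * log 3 4 = log 3 (4 ^ 7 :: real)"
    by (subst log_nat_power) simp_all
  also have "\<dots> \<le> log 3 (3 ^ 9)"
    by (subst log_le_cancel_iff) simp_all
  also have "\<dots> = 9"
    by (subst log_nat_power) simp_all
  finally have "log 3 4 \<le> (9/7::real)"
    by simp
  then have "2 powr log 3 4 \<le> 2 powr (9/7::real)"
    by simp
  also have "\<dots> \<le> 5/2"
  proof (rule power_le_imp_le_base)
    have "(2 powr (9/7)) ^ Suc 6 = (2::real) powr 9"
      by (simp add: powr_power)
    also have "\<dots> = 2 ^ 9"
      by (subst powr_realpow[symmetric]) simp_all
    also have "\<dots> \<le> (5/2) ^ Suc 6"
      by (simp add: power_divide)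
    finally show "(2 powr (9/7)) ^ Suc 6 \<le> (5/2::real) ^ Suc 6" .
  qed simp
  finally show ?thesis .
qed

text \<open>The shift to \<open>m + 1\<close> makes the induction work: scaling by 3 bounds the
  power at \<open>3 * m + 3\<close>, which settles \<open>d = 2\<close>; convexity then descends to
  \<open>3 * m + 1\<close> and \<open>3 * m + 2\<close>, the latter needing
  \<open>2 powr log 3 4 \<le> 5/2\<close>.\<close>

lemma Suc_powr_log34_le: "(real m + 1) powr log 3 4 \<le> 3/2 * real (p34 m) + 1"
proof (induction m rule: digit_induct[of 3])
  case (step m d)
  let ?a = "log 3 4 :: real"
  have a: "1 \<le> ?a"
    by simp
  have triple: "(3 * x) powr ?a = 4 * x powr ?a" if "0 \<le> x" for x :: real
    using that by (simp add: powr_mult)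
  have top: "(3 * real m + 3) powr ?a \<le> 6 * real (p34 m) + 4"
    using triple[of "real m + 1"] step by (simp add: algebra_simps)
  consider "d = 0" | "d = 1" | "d = 2"
    using step by linarith
  then show ?case
  proof cases
    case 1
    have "(1 + 2) powr ?a - 1 powr ?a \<le> (3 * real m + 1 + 2) powr ?a - (3 * real m + 1) powr ?a"
      by (rule powr_diff_mono[OF a]) auto
    then show ?thesis
      using 1 top p34_mult_add[of 0 m] by (simp add: algebra_simps)
  next
    case 2
    have "(2 + 1) powr ?a - 2 powr ?a \<le> (3 * real m + 2 + 1) powr ?a - (3 * real m + 2) powr ?a"
      by (rule powr_diff_mono[OF a]) auto
    then show ?thesis
      using 2 top p34_mult_add[of 1 m] two_powr_log34 by (simp add: algebra_simps)
  next
    case 3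
    then show ?thesis
      using top p34_mult_add[of 2 m] by (simp add: algebra_simps)
  qed
qed simp_all

lemma powr_log34_le: "real m powr log 3 4 \<le> 3/2 * real (p34 m)"
proof (cases "m = 0")
  case False
  let ?a = "log 3 4 :: real"
  \<comment> \<open>By convexity the increment from \<open>m\<close> to \<open>m + 1\<close> is at
    least \<open>2 powr ?a - 1 \<ge> 1\<close>, which absorbs the extra 1.\<close>
  have "(1 + 1) powr ?a - 1 powr ?a \<le> (real m + 1) powr ?a - real m powr ?a"
    using False by (intro powr_diff_mono) auto
  moreover have "2 powr 1 \<le> (2::real) powr ?a"
    by (intro powr_mono) auto
  ultimately show ?thesis
    using Suc_powr_log34_le[of m] by simp
qed simp

theorem theorem9:
  shows "(\<forall>n::nat.
            0 \<le> p34 (nat (- f32 n))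
          \<and> real (p34 (nat (- f32 n))) \<le> (3 * real n + 1) / 4
          \<and> (p34 (nat (- f32 n)) = 0 \<longleftrightarrow> base_rep 4 n \<in> lists {0, 2})
          \<and> (real (p34 (nat (- f32 n))) = (3 * real n + 1) / 4
               \<longleftrightarrow> (\<exists>i::nat. real n = (4 ^ (i + 1) - 1) / 3)))
       \<and> (\<forall>n::nat.
            0 \<le> - f32 n
          \<and> real_of_int (- f32 n) \<le> ((9 * real n + 3) / 8) powr (ln 3 / ln 4))"
proof (intro conjI allI)
  fix n :: nat
  let ?g = "nat (- f32 n)"
  have D: "real_of_int (defect n) = 3 * real n + 1 - 4 * real (p34 ?g)"
    by (simp add: defect_def q34_def)
  show "0 \<le> p34 ?g"
    by simp
  show le: "real (p34 ?g) \<le> (3 * real n + 1) / 4"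
    using D defect_nonneg[of n] by simp
  show "p34 ?g = 0 \<longleftrightarrow> base_rep 4 n \<in> lists {0, 2}"
    using neg_f32_eq_0_iff[of n] neg_f32_nonneg[of n] by simp
  have "real (p34 ?g) = (3 * real n + 1) / 4 \<longleftrightarrow> real_of_int (defect n) = 0"
    unfolding D by (auto simp: field_simps)
  also have "\<dots> \<longleftrightarrow> (\<exists>i. 3 * n + 1 = 4 ^ Suc i)"
    using defect_eq_0_iff[of n] by simp
  also have "\<dots> \<longleftrightarrow> (\<exists>i::nat. real n = (4 ^ (i + 1) - 1) / 3)"
  proof (rule iff_exI)
    fix i
    have "3 * n + 1 = 4 ^ Suc i \<longleftrightarrow> real (3 * n + 1) = real (4 ^ Suc i)"
      by (simp only: of_nat_eq_iff)
    then show "3 * n + 1 = 4 ^ Suc i \<longleftrightarrow> real n = (4 ^ (i + 1) - 1) / 3"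
      by (auto simp: field_simps)
  qed
  finally show "real (p34 ?g) = (3 * real n + 1) / 4 \<longleftrightarrow>
      (\<exists>i::nat. real n = (4 ^ (i + 1) - 1) / 3)" .
  show nonneg: "0 \<le> - f32 n"
    by (rule neg_f32_nonneg)
  have "real ?g = (real ?g powr log 3 4) powr (ln 3 / ln 4)"
    by (simp add: powr_powr log_def)
  \<comment> \<open>The base is \<open>3/2 * ((3 * n + 1) / 4)\<close>, from part (a).\<close>
  also have "\<dots> \<le> ((9 * real n + 3) / 8) powr (ln 3 / ln 4)"
    using le powr_log34_le[of ?g] by (intro powr_mono2) auto
  finally show "real_of_int (- f32 n) \<le> ((9 * real n + 3) / 8) powr (ln 3 / ln 4)"
    using nonneg by simp
qed

end
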